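(* Let $(x_n)_{n\ge 1}$ be a nonincreasing sequence of positive real numbers such that $\sum_{n} x_n = +\infty$, $\lim_{n\to\infty} x_n = 0$, and $\lim_{n\to\infty} \frac{x_{n+1}}{x_n} = 1$. Then, for each real $\ell>0$ and each real $\theta>0$, there exists a subsequence $(x_{n_k})_{k\ge 1}$ for which $\sum_{k} x_{n_k}=\ell$ and $x_{n_k}=O(\theta^k)$.
   Context: A subsequence $(x_{n_k})_{k\ge1}$ is given by a strictly increasing infinite sequence of indices $n_1<n_2<\cdots$. For a real sequence $(a_k)$ and a function $f:\mathbf{N}\to(0,\infty)$, the notation $a_k=O(f(k))$ means $\limsup_{k\to\infty} a_k/f(k)<\infty$. *)

theory Defs
  imports Complex_Main "HOL-Library.Extended_Real" "HOL-Library.Liminf_Limsup"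
begin

text \<open>
  The relation \<open>a\<^sub>k = O(f(k))\<close> for a real sequence \<open>a\<close> and a positive function \<open>f\<close>, in the
  one-sided form \<open>limsup a\<^sub>k / f(k) < \<infinity>\<close>, without absolute values. For nonnegative \<open>a\<close> it
  agrees with Landau's notation. The value of \<open>a\<close> at 0 is irrelevant.
\<close>
definition limsup_bigo :: "(nat \<Rightarrow> real) \<Rightarrow> (nat \<Rightarrow> real) \<Rightarrow> bool"
  where "limsup_bigo a f \<longleftrightarrow> limsup (\<lambda>k. ereal (a k / f k)) < \<infinity>"

text \<open>
  Sequences here are indexed from 1, so index sequences are constrained only on \<open>{1..}\<close>
  and take values there.
\<close>
definition subseq_index :: "(nat \<Rightarrow> nat) \<Rightarrow> bool"
  where "subseq_index \<nu> \<longleftrightarrow> strict_mono_on {1..} \<nu> \<and> (\<forall>k\<ge>1. \<nu> k \<ge> 1)"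

end

theory Submission
  imports Defs
begin

text \<open>
  The subsequence is found greedily. Suppose an amount \<open>s > 0\<close> is still to be reached and let \<open>n\<close>
  be the first admissible index with \<open>x n < s\<close>. If the predecessor was too large, that is
  \<open>s \<le> x (n - 1)\<close>, then choosing \<open>x n\<close> leaves \<open>s - x n \<le> x (n - 1) - x n\<close>. Since consecutive
  terms have ratio tending to 1, this is at most \<open>\<epsilon> * x n\<close> once \<open>n\<close> is large. So each choice
  shrinks the remainder by the factor \<open>\<epsilon>\<close>, for any \<open>\<epsilon>\<close> between 0 and 1 fixed in advance: the
  chosen terms add up to the target, and they decay like \<open>\<epsilon>^k\<close> (lemma \<open>greedy_expansion\<close>). The
  new remainder is below \<open>x n\<close>, so by monotonicity the next index is automatically larger than \<open>n\<close>.

  This needs a target no larger than the term at which the search starts. Divergence of the series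
  provides that: starting from a late index, take consecutive terms for as long as their sum stays
  below \<open>l\<close>. What is then missing from \<open>l\<close> is positive and at most the first term not taken
  (lemma \<open>block_below_target\<close>). These finitely many initial terms affect neither convergence
  nor the rate of decay.
\<close>

text \<open>
  One greedy step. Minimality of \<open>n\<close> gives \<open>s \<le> x (n - 1)\<close>; when \<open>n - 1 = m\<close> this is the
  assumption on \<open>s\<close> instead.
\<close>
lemma greedy_step:
  fixes x :: "nat \<Rightarrow> real"
  assumes lim: "x \<longlonglongrightarrow> 0"
    and slow: "\<And>n. n \<ge> m \<Longrightarrow> x n \<le> (1 + \<epsilon>) * x (Suc n)"
    and s: "0 < s" "s \<le> x m"
  defines "n \<equiv> LEAST n. m < n \<and> x n < s"
  shows "m < n" "x n < s" "s - x n \<le> \<epsilon> * x n"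
proof -
  have "eventually (\<lambda>n. m < n \<and> x n < s) sequentially"
    using eventually_gt_at_top[of m] order_tendstoD(2)[OF lim s(1)] by (rule eventually_conj)
  then have "\<exists>n. m < n \<and> x n < s"
    by (auto simp: eventually_sequentially)
  then have n: "m < n \<and> x n < s"
    unfolding n_def by (rule LeastI_ex)
  then show "m < n" "x n < s" by auto
  then obtain i where i: "n = Suc i" "m \<le> i"
    by (cases n) auto
  have "\<not> (m < i \<and> x i < s)"
    using not_less_Least[of i "\<lambda>n. m < n \<and> x n < s"] i(1) unfolding n_def by simp
  then have "s \<le> x i"
    using i(2) s(2) by (cases "i = m") auto
  also have "x i \<le> (1 + \<epsilon>) * x n"
    using slow[OF i(2)] i(1) by simp
  finally show "s - x n \<le> \<epsilon> * x n"
    by (simp add: algebra_simps)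
qed

lemma greedy_expansion:
  fixes x :: "nat \<Rightarrow> real"
  assumes anti: "antimono_on {m..} x"
    and pos: "\<And>n. n \<ge> m \<Longrightarrow> x n > 0"
    and lim: "x \<longlonglongrightarrow> 0"
    and slow: "\<And>n. n \<ge> m \<Longrightarrow> x n \<le> (1 + \<epsilon>) * x (Suc n)"
    and eps: "0 < \<epsilon>" "\<epsilon> < 1"
    and r: "0 < r" "r \<le> x m"
  shows "\<exists>\<mu>. strict_mono \<mu> \<and> (\<forall>j. m < \<mu> j) \<and> (\<lambda>j. x (\<mu> j)) sums r
    \<and> (\<forall>j. x (\<mu> j) \<le> r * \<epsilon> ^ j)"
proof -
  define g where "g s = (LEAST n. m < n \<and> x n < s)" for s
  have step: "m < g s" "x (g s) < s" "s - x (g s) \<le> \<epsilon> * x (g s)" if "0 < s" "s \<le> x m" for s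
    using greedy_step[OF lim slow that] unfolding g_def by auto
  \<comment> \<open>\<open>R j\<close> is what remains of \<open>r\<close> after \<open>j\<close> choices. It never reaches 0, because a chosen term is
      strictly smaller than the remainder; hence the choices go on forever.\<close>
  define R where "R j = ((\<lambda>s. s - x (g s)) ^^ j) r" for j
  define \<mu> where "\<mu> j = g (R j)" for j
  have R_0: "R 0 = r" and R_Suc: "R (Suc j) = R j - x (\<mu> j)" for j
    by (simp_all add: R_def \<mu>_def)
  have R: "0 < R j \<and> R j \<le> r * \<epsilon> ^ j \<and> R j \<le> x m" for j
  proof (induction j)
    case 0
    show ?case using r by (simp add: R_0)
  next
    case (Suc j)
    have *: "m < \<mu> j" "x (\<mu> j) < R j" "R (Suc j) \<le> \<epsilon> * x (\<mu> j)"
      unfolding R_Suc \<mu>_def using Suc step[of "R j"] by auto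
    have "R (Suc j) \<le> \<epsilon> * R j"
      using *(2,3) eps(1) by (smt (verit) mult_left_mono)
    also have "\<dots> \<le> \<epsilon> * (r * \<epsilon> ^ j)"
      using Suc eps(1) by (intro mult_left_mono) auto
    finally have "R (Suc j) \<le> r * \<epsilon> ^ Suc j" by (simp add: mult_ac)
    moreover have "R (Suc j) \<le> x m"
      using Suc pos[of "\<mu> j"] *(1) by (simp add: R_Suc)
    ultimately show ?case using *(2) by (simp add: R_Suc)
  qed
  have \<mu>: "m < \<mu> j" "x (\<mu> j) < R j" "R (Suc j) \<le> \<epsilon> * x (\<mu> j)" for j
    unfolding R_Suc \<mu>_def using R[of j] step[of "R j"] by auto
  have "strict_mono \<mu>"
  proof (rule strict_mono_Suc_iff[THEN iffD2], intro allI)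
    fix j
    have "x (\<mu> (Suc j)) < \<epsilon> * x (\<mu> j)"
      using \<mu>(2)[of "Suc j"] \<mu>(3)[of j] by simp
    also have "\<dots> < x (\<mu> j)"
      using pos[of "\<mu> j"] \<mu>(1)[of j] eps(2) by simp
    finally have less: "x (\<mu> (Suc j)) < x (\<mu> j)" .
    show "\<mu> j < \<mu> (Suc j)"
    proof (rule ccontr)
      assume "\<not> \<mu> j < \<mu> (Suc j)"
      then have "x (\<mu> j) \<le> x (\<mu> (Suc j))"
        using \<mu>(1)[of j] \<mu>(1)[of "Suc j"] by (intro monotone_onD[OF anti]) auto
      with less show False by simp
    qed
  qed
  moreover have "(\<lambda>j. x (\<mu> j)) sums r"
  proof -
    have "(\<lambda>j. r * \<epsilon> ^ j) \<longlonglongrightarrow> r * 0"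
      using eps by (intro tendsto_mult tendsto_const LIMSEQ_power_zero) auto
    then have "R \<longlonglongrightarrow> 0"
      using R by (intro real_tendsto_sandwich[of "\<lambda>_. 0" R _ "\<lambda>j. r * \<epsilon> ^ j"])
        (auto intro: always_eventually less_imp_le)
    from telescope_sums'[OF this] show ?thesis
      by (simp add: R_0 R_Suc)
  qed
  moreover have "x (\<mu> j) \<le> r * \<epsilon> ^ j" for j
    using \<mu>(2)[of j] R[of j] by linarith
  ultimately show ?thesis
    using \<mu>(1) by blast
qed

text \<open>
  Adding consecutive terms, the sum must overshoot \<open>l\<close>, and it does so by a single term; just before
  that, the gap to \<open>l\<close> is at most this term. The block is empty if its first term already
  reaches \<open>l\<close>.
\<close>
lemma block_below_target:
  fixes x :: "nat \<Rightarrow> real"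
  assumes div: "filterlim (\<lambda>n. \<Sum>i=1..n. x i) at_top sequentially"
    and "l > 0" "N \<ge> 1"
  obtains p where "(\<Sum>i<p. x (N + i)) < l" "l \<le> (\<Sum>i<p. x (N + i)) + x (N + p)"
proof -
  define S where "S p = (\<Sum>i<p. x (N + i))" for p
  have split: "(\<Sum>i=1..<N + p. x i) = (\<Sum>i=1..<N. x i) + S p" for p
  proof -
    have "S p = (\<Sum>i=N..<N + p. x i)"
      unfolding S_def by (subst sum.atLeastLessThan_shift_0) (simp add: atLeast0LessThan)
    then show ?thesis
      using sum.atLeastLessThan_concat[of 1 N "N + p" x] \<open>N \<ge> 1\<close> by simp
  qed
  have "eventually (\<lambda>n. (\<Sum>i=1..<N. x i) + l \<le> (\<Sum>i=1..n. x i)) sequentially"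
    using div by (simp add: filterlim_at_top)
  then obtain n where n: "N \<le> n" "(\<Sum>i=1..<N. x i) + l \<le> (\<Sum>i=1..n. x i)"
    unfolding eventually_sequentially by (metis nle_le)
  have "(\<Sum>i=1..n. x i) = (\<Sum>i=1..<N + (Suc n - N). x i)"
    using n(1) by (intro sum.cong) auto
  with n(2) split[of "Suc n - N"] have "l \<le> S (Suc n - N)"
    by simp
  moreover have "\<not> l \<le> S 0"
    using \<open>l > 0\<close> by (simp add: S_def)
  ultimately obtain p where "\<not> l \<le> S p" "l \<le> S (Suc p)"
    using ex_least_nat_less[of "\<lambda>p. l \<le> S p"] by (metis order_refl)
  with that[of p] show ?thesis
    by (simp add: S_def)
qed

lemma eventually_le_mult_Suc:
  fixes x :: "nat \<Rightarrow> real"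
  assumes pos: "\<And>n. n \<ge> 1 \<Longrightarrow> x n > 0"
    and ratio: "(\<lambda>n. x (n + 1) / x n) \<longlonglongrightarrow> 1"
    and "\<epsilon> > 0"
  shows "eventually (\<lambda>n. x n \<le> (1 + \<epsilon>) * x (Suc n)) sequentially"
proof -
  have "eventually (\<lambda>n. 1 / (1 + \<epsilon>) < x (n + 1) / x n) sequentially"
    using \<open>\<epsilon> > 0\<close> by (intro order_tendstoD(1)[OF ratio]) simp
  then show ?thesis
    using eventually_ge_at_top[of 1]
  proof eventually_elim
    case (elim n)
    then show ?case
      using pos[of n] \<open>\<epsilon> > 0\<close> by (simp add: field_simps)
  qed
qed

theorem corollary5:
  fixes x :: "nat \<Rightarrow> real" and l \<theta> :: real
  assumes "\<And>n. n \<ge> 1 \<Longrightarrow> x n > 0"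
    and "antimono_on {1..} x"
    and "filterlim (\<lambda>N. \<Sum>n=1..N. x n) at_top sequentially"
    and "x \<longlonglongrightarrow> 0"
    and "(\<lambda>n. x (n + 1) / x n) \<longlonglongrightarrow> 1"
    and "l > 0" and "\<theta> > 0"
  shows "\<exists>\<nu>. subseq_index \<nu>
    \<and> (\<lambda>k. x (\<nu> (k + 1))) sums l
    \<and> limsup_bigo (\<lambda>k. x (\<nu> k)) (\<lambda>k. \<theta> ^ k)"
proof -
  \<comment> \<open>The remainders must shrink at the required rate \<open>\<theta>\<close>, and must tend to 0 even if \<open>\<theta> \<ge> 1\<close>.\<close>
  define \<epsilon> where "\<epsilon> = min \<theta> (1 / 2)"
  have eps: "0 < \<epsilon>" "\<epsilon> < 1" "\<epsilon> \<le> \<theta>"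
    using \<open>\<theta> > 0\<close> by (auto simp: \<epsilon>_def)
  have "eventually (\<lambda>n. 1 \<le> n \<and> x n \<le> (1 + \<epsilon>) * x (Suc n)) sequentially"
    using eventually_le_mult_Suc[OF assms(1,5) eps(1)]
    by (intro eventually_conj eventually_ge_at_top)
  then obtain N where N: "1 \<le> N" "\<And>n. n \<ge> N \<Longrightarrow> x n \<le> (1 + \<epsilon>) * x (Suc n)"
    by (auto simp: eventually_sequentially)
  obtain p where p: "(\<Sum>i<p. x (N + i)) < l" "l \<le> (\<Sum>i<p. x (N + i)) + x (N + p)"
    using block_below_target[OF assms(3,6) N(1)] .
  define r where "r = l - (\<Sum>i<p. x (N + i))"
  have r: "0 < r" "r \<le> x (N + p)"
    using p by (auto simp: r_def)
  have anti: "antimono_on {N + p..} x"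
    using assms(2) by (rule monotone_on_subset) (use N(1) in auto)
  have late: "x n > 0" "x n \<le> (1 + \<epsilon>) * x (Suc n)" if "n \<ge> N + p" for n
    using that N assms(1)[of n] by simp_all
  obtain \<mu> where \<mu>: "strict_mono \<mu>" "\<And>j. N + p < \<mu> j" "(\<lambda>j. x (\<mu> j)) sums r"
      "\<And>j. x (\<mu> j) \<le> r * \<epsilon> ^ j"
    using greedy_expansion[OF anti late(1) assms(4) late(2) eps(1,2) r] by auto
  \<comment> \<open>Counting from 0: the block \<open>N, \<dots>, N + p - 1\<close>, then the greedy choices.\<close>
  define \<kappa> where "\<kappa> k = (if k < p then N + k else \<mu> (k - p))" for k
  have \<kappa>_shift: "\<kappa> (j + p) = \<mu> j" for j
    by (simp add: \<kappa>_def)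
  have "strict_mono \<kappa>"
  proof (rule strict_monoI)
    fix a b :: nat
    assume "a < b"
    then show "\<kappa> a < \<kappa> b"
      using \<mu>(2)[of "b - p"] by (auto simp: \<kappa>_def intro: strict_monoD[OF \<mu>(1)])
  qed
  have \<kappa>_ge: "1 \<le> \<kappa> k" for k
    using N(1) \<mu>(2)[of "k - p"] by (auto simp: \<kappa>_def)
  have "(\<lambda>k. x (\<kappa> (k + p))) sums (l - (\<Sum>i<p. x (\<kappa> i)))"
    using \<mu>(3) by (simp add: \<kappa>_shift r_def) (simp add: \<kappa>_def)
  then have \<kappa>_sums: "(\<lambda>k. x (\<kappa> k)) sums l"
    using sums_iff_shift[of "\<lambda>k. x (\<kappa> k)" p "l - (\<Sum>i<p. x (\<kappa> i))"] by simp
  define \<nu> where "\<nu> k = \<kappa> (k - 1)" for k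
  have "subseq_index \<nu>"
    unfolding subseq_index_def \<nu>_def
    using \<kappa>_ge by (auto intro!: strict_mono_onI strict_monoD[OF \<open>strict_mono \<kappa>\<close>])
  moreover have "(\<lambda>k. x (\<nu> (k + 1))) sums l"
    using \<kappa>_sums by (simp add: \<nu>_def)
  moreover have "limsup_bigo (\<lambda>k. x (\<nu> k)) (\<lambda>k. \<theta> ^ k)"
  proof -
    have "ereal (x (\<nu> k) / \<theta> ^ k) \<le> ereal (r / \<theta> ^ Suc p)" if ge: "k \<ge> Suc p" for k
    proof -
      obtain j where k: "k = Suc p + j"
        using le_Suc_ex[OF ge] by blast
      have "x (\<nu> k) \<le> r * \<epsilon> ^ j"
        using \<mu>(4)[of j] by (simp add: \<nu>_def k \<kappa>_def)
      also have "\<dots> \<le> r * \<theta> ^ j"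
        using eps r(1) by (intro mult_left_mono power_mono) auto
      also have "\<dots> = r / \<theta> ^ Suc p * \<theta> ^ k"
        using \<open>\<theta> > 0\<close> by (simp add: k power_add)
      finally show ?thesis
        using \<open>\<theta> > 0\<close> by (simp only: ereal_less_eq pos_divide_le_eq zero_less_power)
    qed
    then have "limsup (\<lambda>k. ereal (x (\<nu> k) / \<theta> ^ k)) \<le> ereal (r / \<theta> ^ Suc p)"
      by (intro Limsup_bounded eventually_sequentiallyI)
    then show ?thesis
      unfolding limsup_bigo_def by (rule le_less_trans) simp
  qed
  ultimately show ?thesis by blast
qed

end
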